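(* Let $\mathfrak{g}$ be a finite-dimensional complex Lie algebra of dimension $N$, let $\mathfrak{g}_2$ be a codimension $1$ ideal of $\mathfrak{g}$, and let $(x_1,\dots,x_N)$ be a basis of $\mathfrak{g}$ with $x_1\notin\mathfrak{g}_2$ and $x_2,\dots,x_N\in\mathfrak{g}_2$. Let $\pi_2:\mathfrak{g}\to\mathfrak{g}_2$ be the corresponding projection (with kernel $\mathbb{C}x_1$), and let $(\omega^1,\dots,\omega^N)$ be the dual basis of $\mathfrak{g}^*$. Let $B\in(S^2\mathfrak{g}^* )^{\mathfrak{g}}$ be an invariant symmetric bilinear form, and let $B_2\in(S^2\mathfrak{g}_2^* )^{\mathfrak{g}_2}$ be the restriction of $B$ to $\mathfrak{g}_2\times\mathfrak{g}_2$. Put $f=B(\cdot,x_1)\in\mathfrak{g}^*$. Then: (i) $$I_B=d(\omega^1\wedge f)+I_{B_2}\circ(\pi_2\times\pi_2\times\pi_2).$$ (ii) For every $\gamma\in\bigwedge^2\mathfrak{g}_2^*\subset\bigwedge^2\mathfrak{g}^*$, $$d\gamma=\omega^1\wedge\theta_{x_1}(\gamma)+d_{\mathfrak{g}_2}\gamma\circ(\pi_2\times\pi_2\times\pi_2).$$ (iii) Suppose $I_{B_2}\in B^3(\mathfrak{g}_2,\mathbb{C})$, and let $\gamma\in\bigwedge^2\mathfrak{g}_2^*\subset\bigwedge^2\mathfrak{g}^*$ be such that $I_{B_2}=d_{\mathfrak{g}_2}\gamma$. Then $I_B\in B^3(\mathfrak{g},\mathbb{C})$ if and only if $\omega^1\wedge\theta_{x_1}(\gamma)\in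 B^3(\mathfrak{g},\mathbb{C})$. In particular, the condition $\theta_{x_1}(\gamma)=-df$ implies $I_B=d\gamma$.
   Context: The base field is $\mathbb{C}$. For a Lie algebra $\mathfrak{g}$, $B\in S^2\mathfrak{g}^*$ is invariant, written $B\in(S^2\mathfrak{g}^* )^{\mathfrak{g}}$, if $B([Z,X],Y)=-B(X,[Z,Y])$ for all $X,Y,Z\in\mathfrak{g}$; for such $B$, $I_B$ is the 3-form $I_B(X,Y,Z)=B([X,Y],Z)$. $d$ is the Chevalley–Eilenberg coboundary of $\mathfrak{g}$ with trivial coefficients: for $f\in\mathfrak{g}^*$, $df(X,Y)=-f([X,Y])$; for $\gamma\in\bigwedge^2\mathfrak{g}^*$, $d\gamma(X,Y,Z)=-\gamma([X,Y],Z)+\gamma([X,Z],Y)-\gamma([Y,Z],X)$. $d_{\mathfrak{g}_2}$ is the analogous coboundary of $\mathfrak{g}_2$. $B^3(\mathfrak{g},\mathbb{C})=d(\bigwedge^2\mathfrak{g}^* )$ is the space of 3-coboundaries. Wedge products are normalized by $(\omega\wedge f)(X,Y)=\omega(X)f(Y)-\omega(Y)f(X)$ and $(\omega\wedge\beta)(X,Y,Z)=\omega(X)\beta(Y,Z)-\omega(Y)\beta(X,Z)+\omega(Z)\beta(X,Y)$ for $\omega,f\in\mathfrak{g}^*$, $\beta\in\bigwedge^2\mathfrak{g}^*$. The inclusion $\bigwedge^2\mathfrak{g}_2^*\subset\bigwedge^2\mathfrak{g}^*$ extends a form on $\mathfrak{g}_2$ by composing with $\pi_2\times\pi_2$ (so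 it vanishes when one argument is $x_1$). $\theta_{x_1}$ is the coadjoint action of $x_1$ on forms: $(\theta_{x_1}\gamma)(Y,Z)=-\gamma([x_1,Y],Z)-\gamma(Y,[x_1,Z])$. *)

theory Defs
  imports Complex_Main
begin

text \<open>
  A Lie algebra is a whole type with a complex vector space structure and a bracket.  A form on a
  subspace \<open>V\<close> is a function on the whole type of which only the values at arguments from \<open>V\<close>
  matter; conditions on such forms, and equality of them, are therefore relativised to \<open>V\<close>.
  For \<open>V = UNIV\<close> this is ordinary equality of functions.
\<close>

locale complex_lie_algebra = vector_space scale
  for scale :: "complex \<Rightarrow> 'g::ab_group_add \<Rightarrow> 'g" +
  fixes br :: "'g \<Rightarrow> 'g \<Rightarrow> 'g"
  assumes br_add_left: "br (X + Y) Z = br X Z + br Y Z"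
    and br_add_right: "br X (Y + Z) = br X Y + br X Z"
    and br_scale_left: "br (scale c X) Y = scale c (br X Y)"
    and br_scale_right: "br X (scale c Y) = scale c (br X Y)"
    and br_self: "br X X = 0"
    and jacobi: "br X (br Y Z) + br Y (br Z X) + br Z (br X Y) = 0"

locale fin_dim_complex_lie_algebra = complex_lie_algebra scale br
  for scale :: "complex \<Rightarrow> 'g::ab_group_add \<Rightarrow> 'g" and br +
  assumes finite_dimensional: "\<exists>S. finite S \<and> module.span scale S = UNIV"

definition lie_ideal ::
    "(complex \<Rightarrow> 'g::ab_group_add \<Rightarrow> 'g) \<Rightarrow> ('g \<Rightarrow> 'g \<Rightarrow> 'g) \<Rightarrow> 'g set \<Rightarrow> bool" where
  "lie_ideal scale br V \<longleftrightarrow> module.subspace scale V \<and> (\<forall>X. \<forall>Y\<in>V. br X Y \<in> V)"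

definition is_basis ::
    "(complex \<Rightarrow> 'g::ab_group_add \<Rightarrow> 'g) \<Rightarrow> nat \<Rightarrow> (nat \<Rightarrow> 'g) \<Rightarrow> bool" where
  "is_basis scale N x \<longleftrightarrow> inj_on x {1..N} \<and> \<not> module.dependent scale (x ` {1..N})
     \<and> module.span scale (x ` {1..N}) = UNIV"

definition is_dual_basis ::
    "(complex \<Rightarrow> 'g::ab_group_add \<Rightarrow> 'g) \<Rightarrow> nat \<Rightarrow> (nat \<Rightarrow> 'g) \<Rightarrow> (nat \<Rightarrow> 'g \<Rightarrow> complex) \<Rightarrow> bool" where
  "is_dual_basis scale N x \<omega> \<longleftrightarrow>
     (\<forall>i\<in>{1..N}. Vector_Spaces.linear scale (*) (\<omega> i) \<and>
        (\<forall>j\<in>{1..N}. \<omega> i (x j) = (if i = j then 1 else 0)))"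

definition is_projection ::
    "(complex \<Rightarrow> 'g::ab_group_add \<Rightarrow> 'g) \<Rightarrow> 'g set \<Rightarrow> 'g set \<Rightarrow> ('g \<Rightarrow> 'g) \<Rightarrow> bool" where
  "is_projection scale V K p \<longleftrightarrow> Vector_Spaces.linear scale scale p \<and> range p = V
     \<and> (\<forall>X\<in>V. p X = X) \<and> {X. p X = 0} = K"

definition bilinear_on ::
    "(complex \<Rightarrow> 'g::ab_group_add \<Rightarrow> 'g) \<Rightarrow> 'g set \<Rightarrow> ('g \<Rightarrow> 'g \<Rightarrow> complex) \<Rightarrow> bool" where
  "bilinear_on scale V \<beta> \<longleftrightarrow>
     (\<forall>X\<in>V. \<forall>Y\<in>V. \<forall>Z\<in>V. \<beta> (X + Y) Z = \<beta> X Z + \<beta> Y Z \<and> \<beta> X (Y + Z) = \<beta> X Y + \<beta> X Z) \<and>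
     (\<forall>X\<in>V. \<forall>Y\<in>V. \<forall>c. \<beta> (scale c X) Y = c * \<beta> X Y \<and> \<beta> X (scale c Y) = c * \<beta> X Y)"

definition alt2_forms ::
    "(complex \<Rightarrow> 'g::ab_group_add \<Rightarrow> 'g) \<Rightarrow> 'g set \<Rightarrow> ('g \<Rightarrow> 'g \<Rightarrow> complex) set" where
  "alt2_forms scale V = {\<gamma>. bilinear_on scale V \<gamma> \<and> (\<forall>X\<in>V. \<gamma> X X = 0)}"

definition inv_sym_forms ::
    "(complex \<Rightarrow> 'g::ab_group_add \<Rightarrow> 'g) \<Rightarrow> ('g \<Rightarrow> 'g \<Rightarrow> 'g) \<Rightarrow> 'g set \<Rightarrow> ('g \<Rightarrow> 'g \<Rightarrow> complex) set" where
  "inv_sym_forms scale br V = {B. bilinear_on scale V B \<and> (\<forall>X\<in>V. \<forall>Y\<in>V. B X Y = B Y X)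
     \<and> (\<forall>X\<in>V. \<forall>Y\<in>V. \<forall>Z\<in>V. B (br Z X) Y = - B X (br Z Y))}"

definition I_form ::
    "('g \<Rightarrow> 'g \<Rightarrow> 'g) \<Rightarrow> ('g \<Rightarrow> 'g \<Rightarrow> complex) \<Rightarrow> 'g \<Rightarrow> 'g \<Rightarrow> 'g \<Rightarrow> complex" where
  "I_form br B = (\<lambda>X Y Z. B (br X Y) Z)"

text \<open>
  The coboundaries of an ideal are given by the same formulas as those of the whole Lie algebra,
  evaluated at arguments from the ideal, because the bracket of the ideal is the restricted one.
\<close>

definition cobd1 ::
    "('g \<Rightarrow> 'g \<Rightarrow> 'g) \<Rightarrow> ('g \<Rightarrow> complex) \<Rightarrow> 'g \<Rightarrow> 'g \<Rightarrow> complex" where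
  "cobd1 br f = (\<lambda>X Y. - f (br X Y))"

definition cobd2 ::
    "('g \<Rightarrow> 'g \<Rightarrow> 'g) \<Rightarrow> ('g \<Rightarrow> 'g \<Rightarrow> complex) \<Rightarrow> 'g \<Rightarrow> 'g \<Rightarrow> 'g \<Rightarrow> complex" where
  "cobd2 br \<gamma> = (\<lambda>X Y Z. - \<gamma> (br X Y) Z + \<gamma> (br X Z) Y - \<gamma> (br Y Z) X)"

definition eq3_on ::
    "'g set \<Rightarrow> ('g \<Rightarrow> 'g \<Rightarrow> 'g \<Rightarrow> complex) \<Rightarrow> ('g \<Rightarrow> 'g \<Rightarrow> 'g \<Rightarrow> complex) \<Rightarrow> bool" where
  "eq3_on V \<phi> \<psi> \<longleftrightarrow> (\<forall>X\<in>V. \<forall>Y\<in>V. \<forall>Z\<in>V. \<phi> X Y Z = \<psi> X Y Z)"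

definition B3 ::
    "(complex \<Rightarrow> 'g::ab_group_add \<Rightarrow> 'g) \<Rightarrow> ('g \<Rightarrow> 'g \<Rightarrow> 'g) \<Rightarrow> 'g set
      \<Rightarrow> ('g \<Rightarrow> 'g \<Rightarrow> 'g \<Rightarrow> complex) set" where
  "B3 scale br V = {\<phi>. \<exists>\<gamma>\<in>alt2_forms scale V. eq3_on V \<phi> (cobd2 br \<gamma>)}"

definition wedge11 :: "('g \<Rightarrow> complex) \<Rightarrow> ('g \<Rightarrow> complex) \<Rightarrow> 'g \<Rightarrow> 'g \<Rightarrow> complex" where
  "wedge11 \<omega> f = (\<lambda>X Y. \<omega> X * f Y - \<omega> Y * f X)"

definition wedge12 ::
    "('g \<Rightarrow> complex) \<Rightarrow> ('g \<Rightarrow> 'g \<Rightarrow> complex) \<Rightarrow> 'g \<Rightarrow> 'g \<Rightarrow> 'g \<Rightarrow> complex" where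
  "wedge12 \<omega> \<beta> = (\<lambda>X Y Z. \<omega> X * \<beta> Y Z - \<omega> Y * \<beta> X Z + \<omega> Z * \<beta> X Y)"

definition coad ::
    "('g::ab_group_add \<Rightarrow> 'g \<Rightarrow> 'g) \<Rightarrow> 'g \<Rightarrow> ('g \<Rightarrow> 'g \<Rightarrow> complex) \<Rightarrow> 'g \<Rightarrow> 'g \<Rightarrow> complex" where
  "coad br x \<gamma> = (\<lambda>Y Z. - \<gamma> (br x Y) Z - \<gamma> Y (br x Z))"

definition pullback2 ::
    "('g \<Rightarrow> 'g) \<Rightarrow> ('g \<Rightarrow> 'g \<Rightarrow> complex) \<Rightarrow> 'g \<Rightarrow> 'g \<Rightarrow> complex" where
  "pullback2 p \<gamma> = (\<lambda>X Y. \<gamma> (p X) (p Y))"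

definition pullback3 ::
    "('g \<Rightarrow> 'g) \<Rightarrow> ('g \<Rightarrow> 'g \<Rightarrow> 'g \<Rightarrow> complex) \<Rightarrow> 'g \<Rightarrow> 'g \<Rightarrow> 'g \<Rightarrow> complex" where
  "pullback3 p \<phi> = (\<lambda>X Y Z. \<phi> (p X) (p Y) (p Z))"

text \<open>The restriction of an invariant form to an ideal is an invariant form on the ideal.\<close>

lemma inv_sym_forms_restrict:
  assumes "complex_lie_algebra scale br" "lie_ideal scale br V"
    and "B \<in> inv_sym_forms scale br UNIV"
    and eq: "\<And>X Y. X \<in> V \<Longrightarrow> Y \<in> V \<Longrightarrow> B2 X Y = B X Y"
  shows "B2 \<in> inv_sym_forms scale br V"
proof -
  interpret complex_lie_algebra scale br by fact
  have V: "subspace V" "\<And>X Y. Y \<in> V \<Longrightarrow> br X Y \<in> V"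
    using assms(2) by (auto simp: lie_ideal_def)
  have B: "bilinear_on scale UNIV B" "\<And>X Y. B X Y = B Y X"
      "\<And>X Y Z. B (br Z X) Y = - B X (br Z Y)"
    using assms(3) unfolding inv_sym_forms_def by blast+
  have "bilinear_on scale V B2"
    using B(1) V(1) by (simp add: bilinear_on_def eq subspace_add subspace_scale)
  moreover have "\<forall>X\<in>V. \<forall>Y\<in>V. B2 X Y = B2 Y X"
    using eq B(2) by metis
  moreover have "\<forall>X\<in>V. \<forall>Y\<in>V. \<forall>Z\<in>V. B2 (br Z X) Y = - B2 X (br Z Y)"
    using eq V(2) B(3) by metis
  ultimately show ?thesis
    by (simp add: inv_sym_forms_def)
qed

end

theory Submission
  imports Defs
begin

text \<open>
  Write \<open>e\<close> for \<open>x 1\<close> and \<open>\<omega>\<close> for \<open>\<omega> 1\<close>, so that \<open>X = \<omega>(X) e + \<pi>2 X\<close> for every \<open>X\<close>.  Everything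
  rests on one fact of multilinear algebra: an alternating 3-form splits as
  \<open>\<phi> = \<omega> \<and> \<iota>\<^sub>e\<phi> + \<pi>2\<^sup>*\<phi>\<close>, because in the expansion of \<open>\<phi>(X,Y,Z)\<close> all terms with two entries \<open>e\<close> vanish
  (\<open>alt3_split\<close>).  What remains is to compute two contractions.

  For \<open>\<phi> = I\<^sub>B\<close>, cyclic invariance gives \<open>\<iota>\<^sub>e I\<^sub>B = f \<circ> [\<cdot>,\<cdot>] = -df\<close>.  A codimension one ideal contains
  all brackets, so \<open>\<omega>\<close> is closed, and the Leibniz rule turns \<open>-\<omega> \<and> df\<close> into \<open>d(\<omega> \<and> f)\<close>: this is (i).
  For \<open>\<phi> = d\<gamma>\<close> with \<open>\<gamma>\<close> pulled back from the ideal, \<open>\<iota>\<^sub>e\<gamma> = 0\<close>, so Cartan's formula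
  \<open>\<iota>\<^sub>e d + d \<iota>\<^sub>e = \<theta>\<^sub>e\<close> gives \<open>\<iota>\<^sub>e d\<gamma> = \<theta>\<^sub>e\<gamma>\<close>: this is (ii).

  If \<open>I\<^bsub>B2\<^esub> = d\<gamma>\<close> on the ideal, the pulled back terms of (i) and (ii) agree, and subtraction yields
  \<open>I\<^sub>B + \<omega> \<and> \<theta>\<^sub>e\<gamma> = d(\<omega> \<and> f + \<gamma>)\<close>.  Hence \<open>I\<^sub>B\<close> and \<open>\<omega> \<and> \<theta>\<^sub>e\<gamma>\<close> are coboundaries simultaneously; and if
  \<open>\<theta>\<^sub>e\<gamma> = -df\<close>, then \<open>\<omega> \<and> \<theta>\<^sub>e\<gamma> = d(\<omega> \<and> f)\<close> cancels and leaves \<open>I\<^sub>B = d\<gamma>\<close>: this is (iii).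
\<close>

section \<open>Alternating forms on a Lie algebra\<close>

text \<open>
  Linearity is demanded in the first slot only; skew symmetry carries it to the other two.
\<close>

definition alt3_forms ::
    "(complex \<Rightarrow> 'g::ab_group_add \<Rightarrow> 'g) \<Rightarrow> ('g \<Rightarrow> 'g \<Rightarrow> 'g \<Rightarrow> complex) set" where
  "alt3_forms scale = {\<phi>. (\<forall>X X' Y Z. \<phi> (X + X') Y Z = \<phi> X Y Z + \<phi> X' Y Z)
     \<and> (\<forall>c X Y Z. \<phi> (scale c X) Y Z = c * \<phi> X Y Z)
     \<and> (\<forall>X Y Z. \<phi> Y X Z = - \<phi> X Y Z) \<and> (\<forall>X Y Z. \<phi> X Z Y = - \<phi> X Y Z)}"

lemma alt2_forms_skew:
  assumes "\<gamma> \<in> alt2_forms scale UNIV"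
  shows "\<gamma> Y X = - \<gamma> X Y"
proof -
  have add: "\<gamma> (X + Y) Z = \<gamma> X Z + \<gamma> Y Z" "\<gamma> X (Y + Z) = \<gamma> X Y + \<gamma> X Z" "\<gamma> X X = 0" for X Y Z
    using assms by (auto simp: alt2_forms_def bilinear_on_def)
  have "\<gamma> (X + Y) (X + Y) = \<gamma> X Y + \<gamma> Y X"
    unfolding add(1,2) by (simp add: add(3))
  then have "\<gamma> X Y + \<gamma> Y X = 0"
    by (simp add: add(3))
  then show ?thesis
    by (simp add: eq_neg_iff_add_eq_0 add.commute)
qed

lemma wedge11_alt2_forms:
  assumes "\<And>X Y. \<omega> (X + Y) = \<omega> X + \<omega> Y" "\<And>c X. \<omega> (scale c X) = c * \<omega> X"
    and "\<And>X Y. f (X + Y) = f X + f Y" "\<And>c X. f (scale c X) = c * f X"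
  shows "wedge11 \<omega> f \<in> alt2_forms scale UNIV"
  by (simp add: alt2_forms_def bilinear_on_def wedge11_def assms algebra_simps)

lemma alt2_forms_add:
  assumes "\<beta> \<in> alt2_forms scale V" "\<gamma> \<in> alt2_forms scale V"
  shows "(\<lambda>X Y. \<beta> X Y + \<gamma> X Y) \<in> alt2_forms scale V"
  using assms by (auto simp: alt2_forms_def bilinear_on_def algebra_simps)

lemma alt2_forms_diff:
  assumes "\<beta> \<in> alt2_forms scale V" "\<gamma> \<in> alt2_forms scale V"
  shows "(\<lambda>X Y. \<beta> X Y - \<gamma> X Y) \<in> alt2_forms scale V"
  using assms by (auto simp: alt2_forms_def bilinear_on_def algebra_simps)

text \<open>
  Two 3-forms whose sum is a coboundary are coboundaries simultaneously, as the coboundaries form a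
  subspace.
\<close>

lemma B3_iff_of_sum_coboundary:
  assumes \<beta>: "\<beta> \<in> alt2_forms scale UNIV"
    and sum: "\<And>X Y Z. \<phi> X Y Z + \<psi> X Y Z = cobd2 br \<beta> X Y Z"
  shows "\<phi> \<in> B3 scale br UNIV \<longleftrightarrow> \<psi> \<in> B3 scale br UNIV"
proof -
  have "\<psi> \<in> B3 scale br UNIV"
    if \<phi>: "\<phi> \<in> B3 scale br UNIV" and sum: "\<And>X Y Z. \<phi> X Y Z + \<psi> X Y Z = cobd2 br \<beta> X Y Z"
    for \<phi> \<psi> :: "'a \<Rightarrow> 'a \<Rightarrow> 'a \<Rightarrow> complex"
  proof -
    obtain \<gamma> where \<gamma>: "\<gamma> \<in> alt2_forms scale UNIV" "\<And>X Y Z. \<phi> X Y Z = cobd2 br \<gamma> X Y Z"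
      using \<phi> by (auto simp: B3_def eq3_on_def)
    have "\<psi> X Y Z = cobd2 br (\<lambda>X Y. \<beta> X Y - \<gamma> X Y) X Y Z" for X Y Z
      using sum[of X Y Z] \<gamma>(2)[of X Y Z] by (simp add: cobd2_def algebra_simps)
    then show ?thesis
      using alt2_forms_diff[OF \<beta> \<gamma>(1)] by (auto simp: B3_def eq3_on_def)
  qed
  from this[of \<phi> \<psi>] this[of \<psi> \<phi>] show ?thesis
    using sum by (auto simp: add.commute)
qed

context complex_lie_algebra
begin

lemma br_skew: "br Y X = - br X Y"
proof -
  have "br (X + Y) (X + Y) = br X Y + br Y X"
    unfolding br_add_left br_add_right by (simp add: br_self)
  then show ?thesis
    by (simp add: br_self eq_neg_iff_add_eq_0 add.commute)
qed

text \<open>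
  Skew symmetry in the first two slots is that of the bracket; in the last two it is invariance of \<open>B\<close>.
\<close>

lemma I_form_alt3:
  assumes "B \<in> inv_sym_forms scale br UNIV"
  shows "I_form br B \<in> alt3_forms scale"
proof -
  have B: "B (X + Y) Z = B X Z + B Y Z" "B (scale c X) Y = c * B X Y"
      "B X Y = B Y X" "B (br Z X) Y = - B X (br Z Y)" for c X Y Z
    using assms unfolding inv_sym_forms_def bilinear_on_def by blast+
  have "B (br Y X) Z = - B (br X Y) Z" for X Y Z
    using B(2)[of "- 1" "br X Y" Z] by (simp add: br_skew[of Y X])
  moreover have "B (br X Z) Y = - B (br X Y) Z" for X Y Z
    using B(4)[of X Z Y] B(3)[of Z "br X Y"] by simp
  moreover have "B (br (X + X') Y) Z = B (br X Y) Z + B (br X' Y) Z"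
      "B (br (scale c X) Y) Z = c * B (br X Y) Z" for c X X' Y Z
    by (simp_all add: br_add_left br_scale_left B(1,2))
  ultimately show ?thesis
    unfolding alt3_forms_def I_form_def by blast
qed

lemma cobd2_alt3:
  assumes "\<gamma> \<in> alt2_forms scale UNIV"
  shows "cobd2 br \<gamma> \<in> alt3_forms scale"
proof -
  have \<gamma>: "\<gamma> (X + Y) Z = \<gamma> X Z + \<gamma> Y Z" "\<gamma> X (Y + Z) = \<gamma> X Y + \<gamma> X Z"
      "\<gamma> (scale c X) Y = c * \<gamma> X Y" "\<gamma> X (scale c Y) = c * \<gamma> X Y" for c X Y Z
    using assms by (auto simp: alt2_forms_def bilinear_on_def)
  have neg: "\<gamma> (br Y X) Z = - \<gamma> (br X Y) Z" for X Y Z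
    using \<gamma>(3)[of "- 1" "br X Y" Z] by (simp add: br_skew[of Y X])
  have "cobd2 br \<gamma> Y X Z = - cobd2 br \<gamma> X Y Z" "cobd2 br \<gamma> X Z Y = - cobd2 br \<gamma> X Y Z" for X Y Z
    by (simp_all add: cobd2_def neg[of Y X Z] neg[of Z Y X])
  then show ?thesis
    by (simp add: alt3_forms_def cobd2_def br_add_left br_scale_left \<gamma> algebra_simps)
qed

end

section \<open>Splitting along a codimension one ideal\<close>

text \<open>
  What an adapted basis contributes to the argument: the components of a vector along \<open>e\<close> and in \<open>V\<close>.
  That \<open>p\<close> is linear and fixes \<open>V\<close> follows from the properties of \<open>\<omega>\<close>, as \<open>p X = X - \<omega>(X) e\<close>.
\<close>

locale codim1_ideal_splitting = complex_lie_algebra scale br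
  for scale :: "complex \<Rightarrow> 'g::ab_group_add \<Rightarrow> 'g" and br +
  fixes V :: "'g set" and e :: 'g and \<omega> :: "'g \<Rightarrow> complex" and p :: "'g \<Rightarrow> 'g"
  assumes ideal: "lie_ideal scale br V"
    and \<omega>_add: "\<omega> (X + Y) = \<omega> X + \<omega> Y"
    and \<omega>_scale: "\<omega> (scale c X) = c * \<omega> X"
    and \<omega>_e: "\<omega> e = 1"
    and \<omega>_ideal: "X \<in> V \<Longrightarrow> \<omega> X = 0"
    and p_in: "p X \<in> V"
    and split: "X = scale (\<omega> X) e + p X"
begin

lemma p_eq: "p X = X - scale (\<omega> X) e"
  using split[of X] by (metis add_diff_cancel_left')

lemma p_ideal: "X \<in> V \<Longrightarrow> p X = X"
  by (simp add: p_eq \<omega>_ideal)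

lemma p_e: "p e = 0"
  by (simp add: p_eq \<omega>_e)

lemma p_add: "p (X + Y) = p X + p Y"
  by (simp add: p_eq \<omega>_add scale_left_distrib)

lemma p_scale: "p (scale c X) = scale c (p X)"
  by (simp add: p_eq \<omega>_scale scale_right_diff_distrib)

text \<open>The quotient by the ideal is one-dimensional, hence abelian.\<close>

lemma br_in_ideal: "br X Y \<in> V"
proof -
  have V: "subspace V" "\<And>X Y. Y \<in> V \<Longrightarrow> br X Y \<in> V"
    using ideal by (auto simp: lie_ideal_def)
  have "br X (p Y) \<in> V" "br (p X) e \<in> V"
    using V(2)[OF p_in] subspace_neg[OF V(1) V(2)[OF p_in, of e X]] by (simp_all add: br_skew[of "p X" e])
  moreover have "br X e = br (p X) e"
    by (subst split[of X]) (simp add: br_add_left br_scale_left br_self)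
  moreover have "br X Y = scale (\<omega> Y) (br X e) + br X (p Y)"
    by (subst split[of Y]) (simp add: br_add_right br_scale_right)
  ultimately show ?thesis
    by (simp add: V(1) subspace_add subspace_scale)
qed

text \<open>
  The splitting is substituted in one slot after the other, and terms containing \<open>e\<close> twice drop out.
  For the same reason \<open>\<phi>(e,Y,Z)\<close> does not change when \<open>Y\<close> and \<open>Z\<close> are projected, which lets the terms with
  a single \<open>e\<close> be collected into a wedge product of forms on the whole algebra.
\<close>

lemma alt3_split:
  assumes "\<phi> \<in> alt3_forms scale"
  shows "\<phi> X Y Z = wedge12 \<omega> (\<phi> e) X Y Z + pullback3 p \<phi> X Y Z"
proof -
  have add1: "\<phi> (X + X') Y Z = \<phi> X Y Z + \<phi> X' Y Z" and scale1: "\<phi> (scale c X) Y Z = c * \<phi> X Y Z"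
    and sk12: "\<phi> Y X Z = - \<phi> X Y Z" and sk23: "\<phi> X Z Y = - \<phi> X Y Z" for c X X' Y Z
    using assms unfolding alt3_forms_def by blast+
  have add2: "\<phi> X (Y + Y') Z = \<phi> X Y Z + \<phi> X Y' Z" and scale2: "\<phi> X (scale c Y) Z = c * \<phi> X Y Z"
    for c X Y Y' Z
    using add1[of Y Y' X Z] scale1[of c Y X Z]
    by (simp_all only: sk12[of X Y Z] sk12[of X Y' Z] sk12[of X "Y + Y'" Z] sk12[of X "scale c Y" Z])
      simp_all
  have add3: "\<phi> X Y (Z + Z') = \<phi> X Y Z + \<phi> X Y Z'" and scale3: "\<phi> X Y (scale c Z) = c * \<phi> X Y Z"
    for c X Y Z Z'
    using add2[of X Z Z' Y] scale2[of X c Z Y]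
    by (simp_all only: sk23[of X Y Z] sk23[of X Y Z'] sk23[of X Y "Z + Z'"] sk23[of X Y "scale c Z"])
      simp_all
  have ee: "\<phi> e e Z = 0" "\<phi> e Z e = 0" for Z
    using sk12[of e e Z] sk23[of e Z e] by simp_all
  have e_p: "\<phi> e Y Z = \<phi> e (p Y) (p Z)" for Y Z
    by (subst (1) split[of Y], subst (1) split[of Z])
      (simp add: add2 add3 scale2 scale3 ee)
  have "\<phi> X Y Z = \<omega> X * \<phi> e Y Z + \<phi> (p X) Y Z"
    by (subst (1) split[of X]) (simp add: add1 scale1)
  also have "\<phi> (p X) Y Z = \<omega> Y * \<phi> (p X) e Z + \<phi> (p X) (p Y) Z"
    by (subst (1) split[of Y]) (simp add: add2 scale2)
  also have "\<phi> (p X) e Z = - \<phi> e X Z"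
    using e_p[of X Z] e_p[of "p X" Z] by (simp add: sk12[of "p X" e Z] p_ideal p_in)
  also have "\<phi> (p X) (p Y) Z = \<omega> Z * \<phi> (p X) (p Y) e + \<phi> (p X) (p Y) (p Z)"
    by (subst (1) split[of Z]) (simp add: add3 scale3)
  also have "\<phi> (p X) (p Y) e = \<phi> e X Y"
    using sk23[of "p X" "p Y" e] sk12[of "p X" e "p Y"] by (simp add: e_p[of X Y])
  finally show ?thesis
    by (simp add: wedge12_def pullback3_def)
qed

text \<open>The Leibniz rule; the term with \<open>d\<omega>\<close> is absent because \<open>\<omega>\<close> vanishes on brackets.\<close>

lemma cobd2_wedge11:
  "cobd2 br (wedge11 \<omega> f) X Y Z = wedge12 \<omega> (\<lambda>X Y. - cobd1 br f X Y) X Y Z"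
  by (simp add: cobd2_def wedge11_def wedge12_def cobd1_def \<omega>_ideal[OF br_in_ideal])

text \<open>Alternation makes \<open>I\<^sub>B\<close> cyclically invariant, which moves \<open>e\<close> out of the bracket.\<close>

lemma I_form_contract:
  assumes "B \<in> inv_sym_forms scale br UNIV"
  shows "I_form br B e Y Z = - cobd1 br (\<lambda>Y. B Y e) Y Z"
proof -
  have "\<phi> e Y Z = \<phi> Y Z e" if "\<phi> \<in> alt3_forms scale" for \<phi>
  proof -
    have "\<phi> e Y Z = - \<phi> Y e Z" "\<phi> Y Z e = - \<phi> Y e Z"
      using that unfolding alt3_forms_def by blast+
    then show ?thesis by simp
  qed
  from this[OF I_form_alt3[OF assms]] show ?thesis
    by (simp add: I_form_def cobd1_def)
qed

lemma I_form_split: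
  assumes B: "B \<in> inv_sym_forms scale br UNIV"
  shows "I_form br B X Y Z =
    cobd2 br (wedge11 \<omega> (\<lambda>Y. B Y e)) X Y Z + pullback3 p (I_form br B) X Y Z"
proof -
  have "I_form br B e = (\<lambda>Y Z. - cobd1 br (\<lambda>Y. B Y e) Y Z)"
    using I_form_contract[OF B] by blast
  then show ?thesis
    using alt3_split[OF I_form_alt3[OF B], of X Y Z] by (simp add: cobd2_wedge11)
qed

lemma pullback2_alt2_forms:
  assumes "\<gamma> \<in> alt2_forms scale V"
  shows "pullback2 p \<gamma> \<in> alt2_forms scale UNIV"
  using assms by (simp add: alt2_forms_def bilinear_on_def pullback2_def p_add p_scale p_in)

text \<open>
  Cartan's formula \<open>\<iota>\<^sub>e d + d \<iota>\<^sub>e = \<theta>\<^sub>e\<close>, in which the second term vanishes because \<open>p e = 0\<close>.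
\<close>

lemma cobd2_pullback2_contract:
  assumes "\<gamma> \<in> alt2_forms scale V"
  shows "cobd2 br (pullback2 p \<gamma>) e Y Z = coad br e (pullback2 p \<gamma>) Y Z"
proof -
  note alt = pullback2_alt2_forms[OF assms]
  have "pullback2 p \<gamma> X (scale 0 e) = 0 * pullback2 p \<gamma> X e" for X
    using alt unfolding alt2_forms_def bilinear_on_def by blast
  then have "pullback2 p \<gamma> X e = 0" for X
    using p_scale[of 0 e] by (simp add: pullback2_def p_e)
  then show ?thesis
    by (simp add: cobd2_def coad_def alt2_forms_skew[OF alt, of "br e Z" Y])
qed

lemma cobd2_pullback2_split:
  assumes \<gamma>: "\<gamma> \<in> alt2_forms scale V"
  shows "cobd2 br (pullback2 p \<gamma>) X Y Z =
    wedge12 \<omega> (coad br e (pullback2 p \<gamma>)) X Y Z + pullback3 p (cobd2 br \<gamma>) X Y Z"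
proof -
  have "cobd2 br (pullback2 p \<gamma>) e = coad br e (pullback2 p \<gamma>)"
    using cobd2_pullback2_contract[OF \<gamma>] by blast
  moreover have "pullback3 p (cobd2 br (pullback2 p \<gamma>)) X Y Z = pullback3 p (cobd2 br \<gamma>) X Y Z"
    by (simp add: pullback3_def cobd2_def pullback2_def p_ideal[OF p_in] p_ideal[OF br_in_ideal])
  ultimately show ?thesis
    using alt3_split[OF cobd2_alt3[OF pullback2_alt2_forms[OF \<gamma>]], of X Y Z] by simp
qed

text \<open>
  The sum is written on the left to suit \<open>B3_iff_of_sum_coboundary\<close>.  It holds because the two
  splittings have the same component pulled back from the ideal.
\<close>

lemma I_form_plus_wedge_coad:
  assumes B: "B \<in> inv_sym_forms scale br UNIV" and \<gamma>: "\<gamma> \<in> alt2_forms scale V"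
    and eq: "eq3_on V (I_form br B) (cobd2 br \<gamma>)"
  shows "I_form br B X Y Z + wedge12 \<omega> (coad br e (pullback2 p \<gamma>)) X Y Z =
    cobd2 br (\<lambda>X Y. wedge11 \<omega> (\<lambda>Y. B Y e) X Y + pullback2 p \<gamma> X Y) X Y Z"
proof -
  have "pullback3 p (I_form br B) X Y Z = pullback3 p (cobd2 br \<gamma>) X Y Z"
    using eq p_in by (simp add: pullback3_def eq3_on_def)
  moreover have "cobd2 br (\<lambda>X Y. wedge11 \<omega> (\<lambda>Y. B Y e) X Y + pullback2 p \<gamma> X Y) X Y Z =
      cobd2 br (wedge11 \<omega> (\<lambda>Y. B Y e)) X Y Z + cobd2 br (pullback2 p \<gamma>) X Y Z"
    by (simp add: cobd2_def)
  ultimately show ?thesis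
    using I_form_split[OF B, of X Y Z] cobd2_pullback2_split[OF \<gamma>, of X Y Z] by simp
qed

lemma I_form_B3_iff:
  assumes B: "B \<in> inv_sym_forms scale br UNIV" and \<gamma>: "\<gamma> \<in> alt2_forms scale V"
    and eq: "eq3_on V (I_form br B) (cobd2 br \<gamma>)"
  shows "I_form br B \<in> B3 scale br UNIV \<longleftrightarrow>
    wedge12 \<omega> (coad br e (pullback2 p \<gamma>)) \<in> B3 scale br UNIV"
proof (rule B3_iff_of_sum_coboundary)
  have "wedge11 \<omega> (\<lambda>Y. B Y e) \<in> alt2_forms scale UNIV"
    using B by (intro wedge11_alt2_forms) (auto simp: \<omega>_add \<omega>_scale inv_sym_forms_def bilinear_on_def)
  then show "(\<lambda>X Y. wedge11 \<omega> (\<lambda>Y. B Y e) X Y + pullback2 p \<gamma> X Y) \<in> alt2_forms scale UNIV"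
    by (rule alt2_forms_add[OF _ pullback2_alt2_forms[OF \<gamma>]])
qed (rule I_form_plus_wedge_coad[OF assms])

lemma I_form_eq_cobd2:
  assumes B: "B \<in> inv_sym_forms scale br UNIV" and \<gamma>: "\<gamma> \<in> alt2_forms scale V"
    and eq: "eq3_on V (I_form br B) (cobd2 br \<gamma>)"
    and coad: "\<And>X Y. coad br e (pullback2 p \<gamma>) X Y = - cobd1 br (\<lambda>Y. B Y e) X Y"
  shows "I_form br B = cobd2 br (pullback2 p \<gamma>)"
proof (intro ext)
  fix X Y Z
  have "coad br e (pullback2 p \<gamma>) = (\<lambda>X Y. - cobd1 br (\<lambda>Y. B Y e) X Y)"
    using coad by blast
  then have "wedge12 \<omega> (coad br e (pullback2 p \<gamma>)) X Y Z = cobd2 br (wedge11 \<omega> (\<lambda>Y. B Y e)) X Y Z"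
    by (simp add: cobd2_wedge11)
  then show "I_form br B X Y Z = cobd2 br (pullback2 p \<gamma>) X Y Z"
    using I_form_plus_wedge_coad[OF B \<gamma> eq, of X Y Z] by (simp add: cobd2_def)
qed

end

text \<open>
  An adapted basis yields the splitting.  The only point is that \<open>\<omega> 1\<close> vanishes on the whole ideal
  and not just on \<open>x 2, \<dots>, x N\<close>: these vectors span the ideal, since a vector of the ideal with a
  nonzero \<open>x 1\<close>-coordinate would put \<open>x 1\<close> into the ideal.
\<close>

lemma codim1_ideal_splitting_of_basis:
  assumes lie: "complex_lie_algebra scale br"
    and ideal: "lie_ideal scale br V"
    and N: "1 \<le> N"
    and basis: "is_basis scale N x"
    and x1: "x 1 \<notin> V"
    and x2: "\<forall>i\<in>{2..N}. x i \<in> V"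
    and proj: "is_projection scale V (module.span scale {x 1}) p"
    and dual: "is_dual_basis scale N x \<omega>"
  shows "codim1_ideal_splitting scale br V (x 1) (\<omega> 1) p"
proof -
  interpret complex_lie_algebra scale br by fact
  have V: "subspace V"
    using ideal by (simp add: lie_ideal_def)
  have lin: "Vector_Spaces.linear scale (*) (\<omega> 1)" and \<omega>x: "\<omega> 1 (x j) = (if 1 = j then 1 else 0)"
    if "j \<in> {1..N}" for j
    using dual N that by (auto simp: is_dual_basis_def)
  interpret \<omega>1: Vector_Spaces.linear scale "(*)" "\<omega> 1"
    using lin[of 1] N by simp
  interpret p: Vector_Spaces.linear scale scale p
    using proj by (simp add: is_projection_def)
  have \<omega>x1: "\<omega> 1 (x 1) = 1"
    using \<omega>x[of 1] N by simp
  have \<omega>V: "\<omega> 1 X = 0" if X: "X \<in> V" for X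
  proof -
    have "{1..N} = insert 1 {2..N}"
      using N by auto
    then have "X \<in> span (insert (x 1) (x ` {2..N}))"
      using basis by (simp add: is_basis_def)
    then obtain k where k: "X - scale k (x 1) \<in> span (x ` {2..N})"
      by (auto simp: span_breakdown_eq)
    also have "span (x ` {2..N}) \<subseteq> V"
      using x2 V by (intro span_minimal) auto
    finally have "scale k (x 1) \<in> V"
      using subspace_diff[OF V X] by fastforce
    then have "k = 0"
      using subspace_scale[OF V, of "scale k (x 1)" "inverse k"] x1 by (cases "k = 0") auto
    then have "X \<in> span (x ` {2..N})"
      using k by simp
    then show ?thesis
      by (induction rule: span_induct_alt) (auto simp: \<omega>1.add \<omega>1.scale \<omega>1.zero \<omega>x simp del: One_nat_def)
  qed
  show ?thesis
  proof unfold_locales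
    show "lie_ideal scale br V" by fact
    show "\<omega> 1 (X + Y) = \<omega> 1 X + \<omega> 1 Y" for X Y
      by (rule \<omega>1.add)
    show "\<omega> 1 (scale c X) = c * \<omega> 1 X" for c X
      by (rule \<omega>1.scale)
    show "\<omega> 1 (x 1) = 1" by fact
    show "\<omega> 1 X = 0" if "X \<in> V" for X
      using that by (rule \<omega>V)
    show pV: "p X \<in> V" for X
      using proj by (auto simp: is_projection_def)
    show "X = scale (\<omega> 1 X) (x 1) + p X" for X
    proof -
      have "p (X - p X) = 0"
        using proj pV[of X] by (simp add: is_projection_def p.diff)
      then have "X - p X \<in> span {x 1}"
        using proj by (auto simp: is_projection_def)
      then obtain k where k: "X - p X = scale k (x 1)"
        by (auto simp: span_singleton)
      then have X: "X = scale k (x 1) + p X"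
        by (simp add: diff_eq_eq)
      have "\<omega> 1 (scale k (x 1) + p X) = k"
        by (simp add: \<omega>1.add \<omega>1.scale \<omega>x1 \<omega>V pV del: One_nat_def)
      then show ?thesis
        using X by simp
    qed
  qed
qed

theorem proposition2p6:
  fixes scale :: "complex \<Rightarrow> 'g::ab_group_add \<Rightarrow> 'g"
    and br :: "'g \<Rightarrow> 'g \<Rightarrow> 'g"
    and N :: nat
    and g2 :: "'g set"
    and x :: "nat \<Rightarrow> 'g"
    and \<omega> :: "nat \<Rightarrow> 'g \<Rightarrow> complex"
    and \<pi>2 :: "'g \<Rightarrow> 'g"
    and B B2 :: "'g \<Rightarrow> 'g \<Rightarrow> complex"
    and f :: "'g \<Rightarrow> complex"
  assumes "fin_dim_complex_lie_algebra scale br"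
    and "vector_space.dim scale (UNIV :: 'g set) = N"
    and "lie_ideal scale br g2"
    and "vector_space.dim scale g2 + 1 = N"
    and "is_basis scale N x"
    and "x 1 \<notin> g2"
    and "\<forall>i\<in>{2..N}. x i \<in> g2"
    and "is_projection scale g2 (module.span scale {x 1}) \<pi>2"
    and "is_dual_basis scale N x \<omega>"
    and "B \<in> inv_sym_forms scale br UNIV"
    and "\<forall>X\<in>g2. \<forall>Y\<in>g2. B2 X Y = B X Y"
    and "f = (\<lambda>Y. B Y (x 1))"
  shows
    "(\<forall>X Y Z. I_form br B X Y Z =
        cobd2 br (wedge11 (\<omega> 1) f) X Y Z + pullback3 \<pi>2 (I_form br B2) X Y Z)
     \<and>
     (\<forall>\<gamma>\<in>alt2_forms scale g2. \<forall>X Y Z.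
        cobd2 br (pullback2 \<pi>2 \<gamma>) X Y Z =
        wedge12 (\<omega> 1) (coad br (x 1) (pullback2 \<pi>2 \<gamma>)) X Y Z
          + pullback3 \<pi>2 (cobd2 br \<gamma>) X Y Z)
     \<and>
     (I_form br B2 \<in> B3 scale br g2 \<longrightarrow>
       (\<forall>\<gamma>\<in>alt2_forms scale g2. eq3_on g2 (I_form br B2) (cobd2 br \<gamma>) \<longrightarrow>
          (I_form br B \<in> B3 scale br UNIV \<longleftrightarrow>
             wedge12 (\<omega> 1) (coad br (x 1) (pullback2 \<pi>2 \<gamma>)) \<in> B3 scale br UNIV)
          \<and> ((\<forall>X Y. coad br (x 1) (pullback2 \<pi>2 \<gamma>) X Y = - cobd1 br f X Y) \<longrightarrow>
               I_form br B = cobd2 br (pullback2 \<pi>2 \<gamma>))))"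
proof -
  have lie: "complex_lie_algebra scale br"
    using assms(1) by (simp add: fin_dim_complex_lie_algebra_def)
  interpret codim1_ideal_splitting scale br g2 "x 1" "\<omega> 1" \<pi>2
    using assms(4) by (intro codim1_ideal_splitting_of_basis[OF lie assms(3) _ assms(5-9)]) simp
  note B = assms(10) and f = assms(12)
  have I2: "I_form br B2 X Y Z = I_form br B X Y Z" if "X \<in> g2" "Y \<in> g2" "Z \<in> g2" for X Y Z
    using that assms(11) br_in_ideal by (simp add: I_form_def)
  have pb: "pullback3 \<pi>2 (I_form br B2) X Y Z = pullback3 \<pi>2 (I_form br B) X Y Z" for X Y Z
    by (simp add: pullback3_def I2 p_in)
  have eq: "eq3_on g2 (I_form br B2) \<phi> \<longleftrightarrow> eq3_on g2 (I_form br B) \<phi>" for \<phi>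
    by (simp add: eq3_on_def I2)
  show ?thesis
    unfolding pb eq f
    by (intro conjI allI ballI impI I_form_split[OF B] cobd2_pullback2_split
        I_form_B3_iff[OF B] I_form_eq_cobd2[OF B]; (assumption | blast))
qed

end
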